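(* For each $i\in\{3,2,1\}$, the group $\mathbb{G}$ of all quaternionic fractional linear transformations maps elements of $\mathcal{F}_i$ onto elements of $\mathcal{F}_i$.
   Context: $\mathbb{H}\cong\mathbb{R}^4$ is the skew field of real quaternions. $\mathbb{G}$ is the group of all maps of $\mathbb{H}\cup\{\infty\}$ of the form $q\mapsto(aq+b)(cq+d)^{-1}$ with $a,b,c,d\in\mathbb{H}$ and $\begin{bmatrix} a & b\\ c & d\end{bmatrix}$ an invertible quaternionic matrix. For $i=3,2,1$, $\mathcal{F}_i=\mathcal{S}_i\cup\mathcal{P}_i$, where $\mathcal{S}_i$ is the family of all $i$-(real)-dimensional (round) spheres of $\mathbb{H}\cong\mathbb{R}^4$ (positive radius) and $\mathcal{P}_i$ is the family of all $i$-(real)-dimensional affine subspaces of $\mathbb{H}$; each affine subspace is understood to be completed with the point $\infty$. *)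

theory Defs
  imports "HOL-Analysis.Analysis"
begin

section \<open>The skew field of real quaternions\<close>

text \<open>\<open>Quaternion t x y z\<close> stands for \<open>t + x i + y j + z k\<close>. The Euclidean structure set up
  below is that of \<open>\<real>\<^sup>4\<close> in the coordinates \<open>(t, x, y, z)\<close>.\<close>

datatype quaternion = Quaternion (re: real) (im1: real) (im2: real) (im3: real)

lemma quaternion_eq_iff:
  "p = q \<longleftrightarrow> re p = re q \<and> im1 p = im1 q \<and> im2 p = im2 q \<and> im3 p = im3 q"
  by (cases p; cases q) simp

instantiation quaternion :: ab_group_add
begin

definition zero_quaternion :: quaternion
  where "zero_quaternion = Quaternion 0 0 0 0"

definition plus_quaternion :: "quaternion \<Rightarrow> quaternion \<Rightarrow> quaternion"
  where "p + q = Quaternion (re p + re q) (im1 p + im1 q) (im2 p + im2 q) (im3 p + im3 q)"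

definition uminus_quaternion :: "quaternion \<Rightarrow> quaternion"
  where "- p = Quaternion (- re p) (- im1 p) (- im2 p) (- im3 p)"

definition minus_quaternion :: "quaternion \<Rightarrow> quaternion \<Rightarrow> quaternion"
  where "p - q = Quaternion (re p - re q) (im1 p - im1 q) (im2 p - im2 q) (im3 p - im3 q)"

instance
  by standard
    (simp_all add: zero_quaternion_def plus_quaternion_def uminus_quaternion_def
      minus_quaternion_def quaternion_eq_iff)

end

lemma quaternion_add_simps [simp]:
  "re 0 = 0" "im1 0 = 0" "im2 0 = 0" "im3 0 = 0"
  "re (p + q) = re p + re q" "im1 (p + q) = im1 p + im1 q"
  "im2 (p + q) = im2 p + im2 q" "im3 (p + q) = im3 p + im3 q"
  "re (- p) = - re p" "im1 (- p) = - im1 p" "im2 (- p) = - im2 p" "im3 (- p) = - im3 p"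
  "re (p - q) = re p - re q" "im1 (p - q) = im1 p - im1 q"
  "im2 (p - q) = im2 p - im2 q" "im3 (p - q) = im3 p - im3 q"
  by (simp_all add: zero_quaternion_def plus_quaternion_def uminus_quaternion_def
      minus_quaternion_def)

instantiation quaternion :: real_vector
begin

definition scaleR_quaternion :: "real \<Rightarrow> quaternion \<Rightarrow> quaternion"
  where "c *\<^sub>R q = Quaternion (c * re q) (c * im1 q) (c * im2 q) (c * im3 q)"

instance
  by standard (simp_all add: scaleR_quaternion_def quaternion_eq_iff algebra_simps)

end

lemma quaternion_scaleR_simps [simp]:
  "re (c *\<^sub>R q) = c * re q" "im1 (c *\<^sub>R q) = c * im1 q"
  "im2 (c *\<^sub>R q) = c * im2 q" "im3 (c *\<^sub>R q) = c * im3 q"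
  by (simp_all add: scaleR_quaternion_def)

lemma quaternion_sum_squares_eq_0_iff:
  "(re q)\<^sup>2 + (im1 q)\<^sup>2 + (im2 q)\<^sup>2 + (im3 q)\<^sup>2 = 0 \<longleftrightarrow> q = 0"
  by (simp add: quaternion_eq_iff add_nonneg_eq_0_iff)

instantiation quaternion :: real_div_algebra
begin

definition one_quaternion :: quaternion
  where "one_quaternion = Quaternion 1 0 0 0"

definition times_quaternion :: "quaternion \<Rightarrow> quaternion \<Rightarrow> quaternion"
  where "p * q = Quaternion
    (re p * re q - im1 p * im1 q - im2 p * im2 q - im3 p * im3 q)
    (re p * im1 q + im1 p * re q + im2 p * im3 q - im3 p * im2 q)
    (re p * im2 q - im1 p * im3 q + im2 p * re q + im3 p * im1 q)
    (re p * im3 q + im1 p * im2 q - im2 p * im1 q + im3 p * re q)"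

definition inverse_quaternion :: "quaternion \<Rightarrow> quaternion"
  where "inverse q = (1 / ((re q)\<^sup>2 + (im1 q)\<^sup>2 + (im2 q)\<^sup>2 + (im3 q)\<^sup>2)) *\<^sub>R
    Quaternion (re q) (- im1 q) (- im2 q) (- im3 q)"

definition divide_quaternion :: "quaternion \<Rightarrow> quaternion \<Rightarrow> quaternion"
  where "p div q = p * inverse q" for p q :: quaternion

instance
proof
  fix p q r :: quaternion and c :: real
  show "p * q * r = p * (q * r)" "(p + q) * r = p * r + q * r" "p * (q + r) = p * q + p * r"
    "1 * p = p" "p * 1 = p" "c *\<^sub>R p * q = c *\<^sub>R (p * q)" "p * c *\<^sub>R q = c *\<^sub>R (p * q)"
    by (simp_all add: times_quaternion_def one_quaternion_def quaternion_eq_iff algebra_simps)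
  show "(0::quaternion) \<noteq> 1"
    by (simp add: one_quaternion_def quaternion_eq_iff)
  show "p div q = p * inverse q"
    by (simp add: divide_quaternion_def)
  show "inverse (0::quaternion) = 0"
    by (simp add: inverse_quaternion_def quaternion_eq_iff)
  assume "p \<noteq> 0"
  then have nz: "(re p)\<^sup>2 + (im1 p)\<^sup>2 + (im2 p)\<^sup>2 + (im3 p)\<^sup>2 \<noteq> 0"
    by (simp add: quaternion_sum_squares_eq_0_iff)
  define N where "N = (re p)\<^sup>2 + (im1 p)\<^sup>2 + (im2 p)\<^sup>2 + (im3 p)\<^sup>2"
  have inv: "inverse p = Quaternion (re p / N) (- (im1 p / N)) (- (im2 p / N)) (- (im3 p / N))"
    by (simp add: inverse_quaternion_def N_def quaternion_eq_iff)
  have one: "(re p * re p + im1 p * im1 p + im2 p * im2 p + im3 p * im3 p) / N = 1"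
    using nz by (simp add: N_def power2_eq_square)
  show "inverse p * p = 1" "p * inverse p = 1"
    using one unfolding inv
    by (simp_all add: times_quaternion_def one_quaternion_def add_divide_distrib mult.commute)
qed

end

lemma quaternion_mult_simps [simp]:
  "re 1 = 1" "im1 1 = 0" "im2 1 = 0" "im3 1 = 0"
  "re (p * q) = re p * re q - im1 p * im1 q - im2 p * im2 q - im3 p * im3 q"
  "im1 (p * q) = re p * im1 q + im1 p * re q + im2 p * im3 q - im3 p * im2 q"
  "im2 (p * q) = re p * im2 q - im1 p * im3 q + im2 p * re q + im3 p * im1 q"
  "im3 (p * q) = re p * im3 q + im1 p * im2 q - im2 p * im1 q + im3 p * re q"
  by (simp_all add: times_quaternion_def one_quaternion_def)

instantiation quaternion :: real_inner
begin

definition inner_quaternion :: "quaternion \<Rightarrow> quaternion \<Rightarrow> real"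
  where "p \<bullet> q = re p * re q + im1 p * im1 q + im2 p * im2 q + im3 p * im3 q"

definition norm_quaternion :: "quaternion \<Rightarrow> real"
  where "norm q = sqrt ((re q)\<^sup>2 + (im1 q)\<^sup>2 + (im2 q)\<^sup>2 + (im3 q)\<^sup>2)"

definition sgn_quaternion :: "quaternion \<Rightarrow> quaternion"
  where "sgn q = q /\<^sub>R norm q" for q :: quaternion

definition dist_quaternion :: "quaternion \<Rightarrow> quaternion \<Rightarrow> real"
  where "dist p q = norm (p - q)" for p q :: quaternion

definition uniformity_quaternion :: "(quaternion \<times> quaternion) filter"
  where "uniformity_quaternion = (INF e\<in>{0<..}. principal {(p, q). dist p q < e})"

definition open_quaternion :: "quaternion set \<Rightarrow> bool"
  where "open_quaternion U \<longleftrightarrow>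
    (\<forall>p\<in>U. eventually (\<lambda>(p', q). p' = p \<longrightarrow> q \<in> U) uniformity)" for U :: "quaternion set"

instance
proof
  fix p q r :: quaternion and c :: real and U :: "quaternion set"
  show "dist p q = norm (p - q)" "sgn p = p /\<^sub>R norm p"
    by (simp_all add: dist_quaternion_def sgn_quaternion_def)
  show "(uniformity :: (quaternion \<times> quaternion) filter) =
      (INF e\<in>{0<..}. principal {(p, q). dist p q < e})"
    by (rule uniformity_quaternion_def)
  show "open U \<longleftrightarrow> (\<forall>p\<in>U. eventually (\<lambda>(p', q). p' = p \<longrightarrow> q \<in> U) uniformity)"
    by (rule open_quaternion_def)
  show "p \<bullet> q = q \<bullet> p" "(p + q) \<bullet> r = p \<bullet> r + q \<bullet> r" "(c *\<^sub>R p) \<bullet> q = c * (p \<bullet> q)"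
    "0 \<le> p \<bullet> p"
    by (simp_all add: inner_quaternion_def algebra_simps)
  show "p \<bullet> p = 0 \<longleftrightarrow> p = 0"
    using quaternion_sum_squares_eq_0_iff[of p]
    by (simp add: inner_quaternion_def power2_eq_square)
  show "norm p = sqrt (p \<bullet> p)"
    by (simp add: inner_quaternion_def norm_quaternion_def power2_eq_square)
qed

end

instance quaternion :: real_normed_div_algebra
proof
  fix p q :: quaternion
  show "norm (p * q) = norm p * norm q"
    unfolding norm_quaternion_def real_sqrt_mult[symmetric] quaternion_mult_simps
    by (rule arg_cong[where f = sqrt]) algebra
qed

instantiation quaternion :: euclidean_space
begin

definition Basis_quaternion :: "quaternion set"
  where "Basis_quaternion =
    {Quaternion 1 0 0 0, Quaternion 0 1 0 0, Quaternion 0 0 1 0, Quaternion 0 0 0 1}"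

instance
proof
  show "(Basis :: quaternion set) \<noteq> {}" "finite (Basis :: quaternion set)"
    by (simp_all add: Basis_quaternion_def)
  fix u v :: quaternion
  assume "u \<in> Basis" "v \<in> Basis"
  then show "u \<bullet> v = (if u = v then 1 else 0)"
    unfolding Basis_quaternion_def by (elim insertE emptyE) (simp_all add: inner_quaternion_def)
next
  fix u :: quaternion
  show "(\<forall>v\<in>Basis. u \<bullet> v = 0) \<longleftrightarrow> u = 0"
    by (simp add: Basis_quaternion_def inner_quaternion_def quaternion_eq_iff[of u 0])
qed

end

lemma DIM_quaternion [simp]: "DIM(quaternion) = 4"
  by (simp add: Basis_quaternion_def)

lemma quaternion_Hamilton:
  defines "i \<equiv> Quaternion 0 1 0 0" and "j \<equiv> Quaternion 0 0 1 0" and "k \<equiv> Quaternion 0 0 0 1"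
  shows "i * i = - 1" "j * j = - 1" "k * k = - 1" "i * j * k = - 1"
  by (simp_all add: i_def j_def k_def quaternion_eq_iff)


section \<open>Quaternionic fractional linear transformations\<close>

text \<open>The extended space \<open>\<H> \<union> {\<infinity>}\<close> is modelled, as in the library's one-point
  compactification, by the option type: \<open>Some q\<close> is the point \<open>q\<close> of \<open>\<H>\<close>, and
  \<open>None\<close> is \<open>\<infinity>\<close>.\<close>

type_synonym ext_quaternion = "quaternion option"

text \<open>The usual conventions at \<open>\<infinity>\<close>: a point where the denominator vanishes is sent to \<open>\<infinity>\<close>,
  and \<open>\<infinity>\<close> is sent to \<open>a c\<inverse>\<close>, or to \<open>\<infinity>\<close> if \<open>c = 0\<close>. (For an invertible
  matrix, numerator and denominator have no common zero, and \<open>a \<noteq> 0\<close> if \<open>c = 0\<close>.)\<close>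

definition frac_lin :: "quaternion^2^2 \<Rightarrow> ext_quaternion \<Rightarrow> ext_quaternion"
  where "frac_lin M z =
    (let a = M$1$1; b = M$1$2; c = M$2$1; d = M$2$2 in
      case z of
        Some q \<Rightarrow> if c * q + d = 0 then None else Some ((a * q + b) * inverse (c * q + d))
      | None \<Rightarrow> if c = 0 then None else Some (a * inverse c))"

definition frac_lin_group :: "(ext_quaternion \<Rightarrow> ext_quaternion) set"
  where "frac_lin_group = {frac_lin M | M. invertible M}"


section \<open>Round spheres and completed affine subspaces\<close>

text \<open>A round \<open>i\<close>-sphere is a sphere of positive radius within some \<open>(i + 1)\<close>-dimensional
  affine subspace containing its centre.\<close>

definition round_spheres :: "nat \<Rightarrow> ext_quaternion set set"
  where "round_spheres i =
    {Some ` (sphere c r \<inter> A) | c r A. 0 < r \<and> affine A \<and> aff_dim A = int i + 1 \<and> c \<in> A}"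

definition affine_subspaces :: "nat \<Rightarrow> ext_quaternion set set"
  where "affine_subspaces i =
    {insert None (Some ` A) | A. affine A \<and> aff_dim A = int i}"

definition sphere_family :: "nat \<Rightarrow> ext_quaternion set set"
  where "sphere_family i = round_spheres i \<union> affine_subspaces i"

end

theory Submission
  imports Defs
begin

text \<open>Send a point \<open>q\<close> of \<open>\<H>\<close> to \<open>(1, q, \<bar>q\<bar>\<^sup>2)\<close> and \<open>\<infinity>\<close> to
  \<open>(0, 0, 1)\<close> in \<open>\<real> \<times> \<H> \<times> \<real>\<close>. This identifies \<open>\<H> \<union> {\<infinity>}\<close> with the set of lines
  on the light cone \<open>s t = \<bar>q\<bar>\<^sup>2\<close>. The equation of a sphere or of a hyperplane is linear in
  \<open>1\<close>, \<open>q\<close> and \<open>\<bar>q\<bar>\<^sup>2\<close>, so in this model round spheres and completed affine subspaces are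
  the same kind of object: the members of \<open>\<F>\<^sub>i\<close> are exactly the sections of the cone by
  linear subspaces of dimension \<open>i + 2\<close> that contain at least two points
  (\<open>sphere_family_eq_proper_sections\<close>). Affine subspaces are the sections through \<open>\<infinity>\<close>.

  A fractional linear transformation is linear in this model. In homogeneous coordinates
  \<open>w \<in> \<H>\<^sup>2\<close> it is \<open>w \<mapsto> M w\<close>; the light cone consists, up to sign, of the rank-one Hermitian matrices
  \<open>w w\<^sup>*\<close>, where \<open>(s, q, t)\<close> is read as the Hermitian matrix with diagonal \<open>t, s\<close> and upper
  right entry \<open>q\<close>; and \<open>M w (M w)\<^sup>* = M (w w\<^sup>*) M\<^sup>*\<close>. Up to a nonzero real factor, then, the lift
  of the image of a point is the image of its lift under the linear bijection \<open>X \<mapsto> M X M\<^sup>*\<close> of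
  Hermitian matrices (\<open>herm_lift_frac_lin\<close>). This bijection permutes the linear subspaces of
  each dimension, hence the transformation permutes the members of \<open>\<F>\<^sub>i\<close>.\<close>

section \<open>Sections of the light cone\<close>

definition lift :: "'a::real_inner option \<Rightarrow> real \<times> 'a \<times> real"
  where "lift z = (case z of None \<Rightarrow> (0, 0, 1) | Some q \<Rightarrow> (1, q, (norm q)\<^sup>2))"

lemma lift_simps [simp]: "lift None = (0, 0, 1)" "lift (Some q) = (1, q, (norm q)\<^sup>2)"
  by (simp_all add: lift_def)

definition cone_section :: "(real \<times> 'a::real_inner \<times> real) set \<Rightarrow> 'a option set"
  where "cone_section V = {z. lift z \<in> V}"

text \<open>A section by a subspace of dimension at least two may still be empty (the subspace misses the
  cone) or a single point (it is tangent to the cone). Requiring two points excludes exactly these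
  two degenerate cases, and it is visibly preserved by bijections of the extended space.\<close>

definition proper_sections :: "nat \<Rightarrow> 'a::euclidean_space option set set"
  where "proper_sections n = {cone_section V | V.
    subspace V \<and> dim V = n \<and> (\<exists>x\<in>cone_section V. \<exists>y\<in>cone_section V. x \<noteq> y)}"

lemma proper_sectionsI:
  assumes "subspace V" "dim V = n" "x \<in> cone_section V" "y \<in> cone_section V" "x \<noteq> y"
  shows "cone_section V \<in> proper_sections n"
  using assms unfolding proper_sections_def by blast

lemma affine_eq_translate_subspace:
  fixes A :: "'a::euclidean_space set"
  assumes "affine A" "p \<in> A"
  obtains U where "subspace U" "A = (\<lambda>u. p + u) ` U" "aff_dim A = int (dim U)"
proof
  let ?U = "(\<lambda>a. - p + a) ` A"
  show "subspace ?U"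
    using assms by (intro affine_diffs_subspace)
  show A: "A = (\<lambda>u. p + u) ` ?U"
    by (simp add: image_image)
  show "aff_dim A = int (dim ?U)"
    using assms by (simp add: aff_dim_dim_affine_diffs image_image algebra_simps)
qed

lemma translate_subspace:
  fixes U :: "'a::euclidean_space set"
  assumes "subspace U"
  shows "affine ((\<lambda>u. p + u) ` U)" "aff_dim ((\<lambda>u. p + u) ` U) = int (dim U)"
  using assms subspace_imp_affine affine_translation[of U p]
  by (auto simp: aff_dim_translation_eq aff_dim_subspace)

text \<open>Since \<open>(0, 0, 1)\<close> lies in the subspace, the last coordinate is unconstrained there;
  homogenizing the condition \<open>q \<in> p + U\<close> to \<open>q \<in> s p + U\<close> is all that is left.\<close>

lemma flat_as_section:
  fixes p :: "'a::euclidean_space"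
  assumes "subspace U"
  defines "V \<equiv> (\<lambda>(s, u, t). (s, s *\<^sub>R p + u, t)) ` (UNIV \<times> U \<times> UNIV)"
  shows "subspace V" "dim V = dim U + 2"
    "cone_section V = insert None (Some ` (\<lambda>u. p + u) ` U)"
proof -
  let ?f = "\<lambda>(s, u, t). (s, s *\<^sub>R p + u, t :: real)"
  have lin: "linear ?f"
    by (auto intro!: linearI simp: algebra_simps)
  have inj: "inj ?f"
    by (auto intro!: injI)
  have sub: "subspace ((UNIV :: real set) \<times> U \<times> (UNIV :: real set))"
    by (intro subspace_Times assms subspace_UNIV)
  show "subspace V"
    unfolding V_def by (rule linear_subspace_image[OF lin sub])
  have "dim V = dim ((UNIV :: real set) \<times> U \<times> (UNIV :: real set))"
    unfolding V_def by (rule dim_image_eq[OF lin]) (rule inj_on_subset[OF inj subset_UNIV])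
  also have "\<dots> = dim U + 2"
    by (simp add: dim_Times subspace_Times assms subspace_UNIV)
  finally show "dim V = dim U + 2" .
  have V_iff: "(s, q, t) \<in> V \<longleftrightarrow> q - s *\<^sub>R p \<in> U" for s q t
    unfolding V_def by (auto simp: image_iff intro!: bexI[of _ "q - s *\<^sub>R p"])
  have "z \<in> cone_section V \<longleftrightarrow> z \<in> insert None (Some ` (\<lambda>u. p + u) ` U)" for z
  proof (cases z)
    case None
    then show ?thesis
      using subspace_0[OF assms(1)] by (simp add: cone_section_def V_iff)
  next
    case (Some q)
    then show ?thesis
      by (auto simp: cone_section_def V_iff image_iff intro!: bexI[of _ "q - p"])
  qed
  then show "cone_section V = insert None (Some ` (\<lambda>u. p + u) ` U)"
    by blast
qed

text \<open>The sphere is \<open>\<bar>q\<bar>\<^sup>2 = 2 c \<bullet> q - (\<bar>c\<bar>\<^sup>2 - r\<^sup>2)\<close>. Replacing \<open>\<bar>q\<bar>\<^sup>2\<close> by \<open>t\<close> and homogenizing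
  with \<open>s\<close> expresses \<open>t\<close> as a linear function of \<open>(s, q)\<close>, so only one dimension is added to
  that of \<open>U\<close>.\<close>

lemma sphere_as_section:
  fixes c :: "'a::euclidean_space"
  assumes "subspace U" "0 < r"
  defines "V \<equiv> (\<lambda>(s, u). (s, s *\<^sub>R c + u, 2 * (c \<bullet> (s *\<^sub>R c + u)) - s * ((norm c)\<^sup>2 - r\<^sup>2)))
    ` (UNIV \<times> U)"
  shows "subspace V" "dim V = dim U + 1"
    "cone_section V = Some ` (sphere c r \<inter> (\<lambda>u. c + u) ` U)"
proof -
  let ?f = "\<lambda>(s, u). (s, s *\<^sub>R c + u, 2 * (c \<bullet> (s *\<^sub>R c + u)) - s * ((norm c)\<^sup>2 - r\<^sup>2))"
  have lin: "linear ?f"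
    by (auto intro!: linearI simp: algebra_simps inner_simps)
  have inj: "inj ?f"
    by (auto intro!: injI)
  have sub: "subspace ((UNIV :: real set) \<times> U)"
    by (intro subspace_Times assms subspace_UNIV)
  show "subspace V"
    unfolding V_def by (rule linear_subspace_image[OF lin sub])
  have "dim V = dim ((UNIV :: real set) \<times> U)"
    unfolding V_def by (rule dim_image_eq[OF lin]) (rule inj_on_subset[OF inj subset_UNIV])
  also have "\<dots> = dim U + 1"
    by (simp add: dim_Times assms subspace_UNIV)
  finally show "dim V = dim U + 1" .
  have V_iff: "(s, q, t) \<in> V \<longleftrightarrow>
      q - s *\<^sub>R c \<in> U \<and> t = 2 * (c \<bullet> q) - s * ((norm c)\<^sup>2 - r\<^sup>2)" for s q t
    unfolding V_def by (auto simp: image_iff intro!: bexI[of _ "q - s *\<^sub>R c"])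
  have "z \<in> cone_section V \<longleftrightarrow> z \<in> Some ` (sphere c r \<inter> (\<lambda>u. c + u) ` U)" for z
  proof (cases z)
    case None
    then show ?thesis
      by (auto simp: cone_section_def V_iff)
  next
    case (Some q)
    have "dist c q = r \<longleftrightarrow> (norm (q - c))\<^sup>2 = r\<^sup>2"
      using assms(2) by (simp add: dist_norm norm_minus_commute)
    also have "\<dots> \<longleftrightarrow> (norm q)\<^sup>2 = 2 * (c \<bullet> q) - ((norm c)\<^sup>2 - r\<^sup>2)"
      by (auto simp: power2_norm_eq_inner inner_simps inner_commute)
    finally show ?thesis
      using Some by (auto simp: cone_section_def V_iff image_iff intro!: bexI[of _ "q - c"])
  qed
  then show "cone_section V = Some ` (sphere c r \<inter> (\<lambda>u. c + u) ` U)"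
    by blast
qed

text \<open>The centre \<open>e\<close> need not lie in \<open>A\<close>. By Pythagoras, the distance to \<open>e\<close> and the distance
  to the orthogonal projection \<open>c\<close> of \<open>e\<close> onto \<open>A\<close> have the same level sets in \<open>A\<close>; a second
  point of the level set keeps the new radius from being \<open>0\<close>.\<close>

lemma affine_Int_sphere_recentre:
  fixes A :: "'a::euclidean_space set"
  assumes "affine A" "p \<in> A" "p' \<in> A" "p \<noteq> p'" "dist e p = dist e p'"
  obtains c r where "0 < r" "c \<in> A" "{q \<in> A. dist e q = dist e p} = sphere c r \<inter> A"
proof -
  obtain U where U: "subspace U" "A = (\<lambda>u. p + u) ` U"
    using affine_eq_translate_subspace[OF assms(1,2)] by blast
  obtain y z where yz: "y \<in> U" "\<And>w. w \<in> U \<Longrightarrow> orthogonal z w" "e - p = y + z"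
    using orthogonal_subspace_decomp_exists[of U "e - p"] U(1)
    by (metis span_eq_iff)
  define c where "c = p + y"
  have cA: "c \<in> A"
    using yz(1) U(2) by (auto simp: c_def)
  have pyth: "(dist e q)\<^sup>2 = (dist c q)\<^sup>2 + (norm z)\<^sup>2" if q: "q \<in> A" for q
  proof -
    obtain u where u: "u \<in> U" "q = p + u"
      using q U(2) by blast
    have "orthogonal z (y - u)"
      using U(1) yz u by (simp add: subspace_diff)
    moreover have "e - q = (y - u) + z" "c - q = y - u"
      using yz(3) u by (auto simp: c_def algebra_simps)
    ultimately show ?thesis
      by (simp add: dist_norm norm_add_Pythagorean orthogonal_commute)
  qed
  have iff: "dist e q = dist e p \<longleftrightarrow> dist c q = dist c p" if "q \<in> A" for q
    using pyth[OF that] pyth[OF assms(2)]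
    by (metis add_right_cancel power2_eq_iff_nonneg zero_le_dist)
  show thesis
  proof
    show "0 < dist c p"
      using iff[OF assms(3)] assms(4,5) by (metis dist_eq_0_iff zero_less_dist_iff)
    show "c \<in> A" by (rule cA)
    show "{q \<in> A. dist e q = dist e p} = sphere c (dist c p) \<inter> A"
      using iff by auto
  qed
qed

text \<open>Subtracting multiples of \<open>(0, 0, 1)\<close> and of the lift of \<open>p\<close> reduces membership in
  \<open>V\<close> to vectors of the form \<open>(0, u, 0)\<close>, so \<open>V\<close> is the subspace attached to a flat.\<close>

lemma unbounded_section_is_flat:
  fixes V :: "(real \<times> 'a::euclidean_space \<times> real) set"
  assumes V: "subspace V" and inf: "(0, 0, 1) \<in> V" and p: "Some p \<in> cone_section V"
  obtains U where "subspace U" "dim V = dim U + 2"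
    "cone_section V = insert None (Some ` (\<lambda>u. p + u) ` U)"
proof -
  define U where "U = {u. (0, u, 0) \<in> V}"
  have "linear (\<lambda>u::'a. (0::real, u, 0::real))"
    by (auto intro!: linearI)
  from linear_subspace_vimage[OF this V] have U: "subspace U"
    by (simp add: U_def vimage_def)
  have base: "(1, p, (norm p)\<^sup>2) \<in> V"
    using p by (simp add: cone_section_def)
  have iff: "(s, q, t) \<in> V \<longleftrightarrow> q - s *\<^sub>R p \<in> U" for s q t
  proof -
    let ?w = "s *\<^sub>R (1, p, (norm p)\<^sup>2) + (t - s * (norm p)\<^sup>2) *\<^sub>R (0, 0, 1)"
    have w: "?w \<in> V"
      using V base inf by (intro subspace_add subspace_scale)
    have "(s, q, t) = (0, q - s *\<^sub>R p, 0) + ?w"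
      by simp
    then show ?thesis
      unfolding U_def using subspace_add[OF V _ w, of "(0, q - s *\<^sub>R p, 0)"]
        subspace_diff[OF V _ w, of "(s, q, t)"] by auto
  qed
  have "(s, q, t) \<in> V \<longleftrightarrow>
      (s, q, t) \<in> (\<lambda>(s, u, t). (s, s *\<^sub>R p + u, t)) ` (UNIV \<times> U \<times> UNIV)" for s q t
    by (auto simp: image_iff iff intro!: bexI[of _ "q - s *\<^sub>R p"])
  then have "V = (\<lambda>(s, u, t). (s, s *\<^sub>R p + u, t)) ` (UNIV \<times> U \<times> UNIV)"
    by (metis (no_types, lifting) prod_cases3 subsetI subset_antisym)
  with flat_as_section[OF U, of p] show thesis
    using U that by simp
qed

text \<open>The component \<open>z\<close> of \<open>(0, 0, 1)\<close> orthogonal to \<open>V\<close> has a nonzero last coordinate, so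
  orthogonality to \<open>z\<close> is a linear equation on \<open>V\<close> that can be solved for \<open>t\<close>. On lifted points
  it becomes the equation of a sphere whose centre \<open>e\<close> may lie outside the affine subspace of
  the section, which is why the sphere then has to be recentred.\<close>

lemma bounded_section_is_sphere:
  fixes V :: "(real \<times> 'a::euclidean_space \<times> real) set"
  assumes V: "subspace V" and inf: "(0, 0, 1) \<notin> V"
    and p: "Some p \<in> cone_section V" "Some p' \<in> cone_section V" "p \<noteq> p'"
  obtains A c r where "affine A" "int (dim V) = aff_dim A + 1" "0 < r" "c \<in> A"
    "cone_section V = Some ` (sphere c r \<inter> A)"
proof -
  obtain y z where yz: "y \<in> V" "\<And>w. w \<in> V \<Longrightarrow> orthogonal z w" "(0, 0, 1) = y + z"
    using orthogonal_subspace_decomp_exists[of V "(0, 0, 1)"] V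
    by (metis span_eq_iff)
  obtain z0 z1 z2 where z: "z = (z0, z1, z2)"
    by (cases z) auto
  have "z \<noteq> 0"
    using yz inf by auto
  have "z2 = z \<bullet> (0, 0, 1)"
    by (simp add: z)
  also have "\<dots> = z \<bullet> z"
    using yz by (simp add: inner_add_right orthogonal_def)
  finally have "z2 \<noteq> 0"
    using \<open>z \<noteq> 0\<close> by simp
  \<comment> \<open>Solving \<open>z0 s + z1 \<bullet> q + z2 t = 0\<close> for \<open>t\<close> gives \<open>t = 2 e \<bullet> q - k s\<close>.\<close>
  define e where "e = - (1 / (2 * z2)) *\<^sub>R z1"
  define k where "k = z0 / z2"
  have V_eqn: "t = 2 * (e \<bullet> q) - s * k" if "(s, q, t) \<in> V" for s q t
  proof -
    have "z0 * s + z1 \<bullet> q + z2 * t = 0"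
      using yz(2)[OF that] by (simp add: orthogonal_def z)
    then show ?thesis
      using \<open>z2 \<noteq> 0\<close> by (simp add: e_def k_def field_simps)
  qed
  define U where "U = {u. (0, u, 2 * (e \<bullet> u)) \<in> V}"
  have "linear (\<lambda>u::'a. (0::real, u, 2 * (e \<bullet> u)))"
    by (auto intro!: linearI simp: inner_simps)
  from linear_subspace_vimage[OF this V] have U: "subspace U"
    by (simp add: U_def vimage_def)
  have base: "(1, p, 2 * (e \<bullet> p) - k) \<in> V"
    using p(1) V_eqn[of 1 p "(norm p)\<^sup>2"] by (simp add: cone_section_def)
  let ?f = "\<lambda>(s, u). (s, s *\<^sub>R p + u, 2 * (e \<bullet> (s *\<^sub>R p + u)) - s * k)"
  have iff: "(s, q, t) \<in> V \<longleftrightarrow> q - s *\<^sub>R p \<in> U \<and> t = 2 * (e \<bullet> q) - s * k" for s q t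
  proof -
    let ?w = "s *\<^sub>R (1, p, 2 * (e \<bullet> p) - k)"
    have w: "?w \<in> V"
      using V base by (intro subspace_scale)
    have "(s, q, 2 * (e \<bullet> q) - s * k) = (0, q - s *\<^sub>R p, 2 * (e \<bullet> (q - s *\<^sub>R p))) + ?w"
      by (simp add: inner_simps algebra_simps)
    then have "(s, q, 2 * (e \<bullet> q) - s * k) \<in> V \<longleftrightarrow> q - s *\<^sub>R p \<in> U"
      unfolding U_def using subspace_add[OF V _ w, of "(0, q - s *\<^sub>R p, 2 * (e \<bullet> (q - s *\<^sub>R p)))"]
        subspace_diff[OF V _ w, of "(s, q, 2 * (e \<bullet> q) - s * k)"] by auto
    then show ?thesis
      using V_eqn by blast
  qed
  have "(s, q, t) \<in> V \<longleftrightarrow> (s, q, t) \<in> ?f ` (UNIV \<times> U)" for s q t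
    by (auto simp: image_iff iff intro!: bexI[of _ "q - s *\<^sub>R p"])
  then have "V = ?f ` (UNIV \<times> U)"
    by (metis (no_types, lifting) prod_cases3 subsetI subset_antisym)
  moreover have "linear ?f"
    by (auto intro!: linearI simp: algebra_simps inner_simps)
  moreover have "inj_on ?f S" for S
    by (auto intro!: inj_onI)
  ultimately have "dim V = dim ((UNIV :: real set) \<times> U)"
    using dim_image_eq[of ?f "UNIV \<times> U"] by simp
  then have dimV: "dim V = dim U + 1"
    by (simp add: dim_Times U subspace_UNIV)
  define A where "A = (\<lambda>u. p + u) ` U"
  have A: "affine A"
    unfolding A_def by (rule translate_subspace(1)[OF U])
  have dimA: "aff_dim A = int (dim U)"
    unfolding A_def by (rule translate_subspace(2)[OF U])
  have "q \<in> A \<longleftrightarrow> q - p \<in> U" for q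
    unfolding A_def by (auto simp: image_iff intro!: bexI[of _ "q - p"])
  then have sec: "Some q \<in> cone_section V \<longleftrightarrow> q \<in> A \<and> (norm q)\<^sup>2 = 2 * (e \<bullet> q) - k" for q
    by (simp add: cone_section_def iff)
  have norm_p: "(norm p)\<^sup>2 = 2 * (e \<bullet> p) - k" and pA: "p \<in> A" "p' \<in> A"
    using p sec by auto
  have dist_iff: "(norm q)\<^sup>2 = 2 * (e \<bullet> q) - k \<longleftrightarrow> dist e q = dist e p" for q
  proof -
    have "dist e q = dist e p \<longleftrightarrow> (norm (e - q))\<^sup>2 = (norm (e - p))\<^sup>2"
      by (simp add: dist_norm)
    also have "\<dots> \<longleftrightarrow> (norm q)\<^sup>2 = 2 * (e \<bullet> q) - k"
      using norm_p by (auto simp: power2_norm_eq_inner inner_simps inner_commute)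
    finally show ?thesis by simp
  qed
  obtain c r where cr: "0 < r" "c \<in> A" "{q \<in> A. dist e q = dist e p} = sphere c r \<inter> A"
    using affine_Int_sphere_recentre[OF A pA \<open>p \<noteq> p'\<close>, of e] p sec dist_iff by metis
  have "None \<notin> cone_section V"
    using inf by (simp add: cone_section_def)
  then have "z \<in> cone_section V \<longleftrightarrow> z \<in> Some ` {q \<in> A. dist e q = dist e p}" for z
    using sec dist_iff by (cases z) auto
  then have "cone_section V = Some ` (sphere c r \<inter> A)"
    unfolding cr(3) by blast
  then show thesis
    using that[OF A _ cr(1,2)] dimV dimA by simp
qed

lemma sphere_family_eq_proper_sections: "sphere_family i = proper_sections (i + 2)"
proof (intro equalityI subsetI)
  fix X assume "X \<in> sphere_family i"
  then consider (sphere) c r A where "X = Some ` (sphere c r \<inter> A)" "0 < r" "affine A"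
      "aff_dim A = int i + 1" "c \<in> A"
    | (flat) A where "X = insert None (Some ` A)" "affine A" "aff_dim A = int i"
    unfolding sphere_family_def round_spheres_def affine_subspaces_def by blast
  then show "X \<in> proper_sections (i + 2)"
  proof cases
    case sphere
    obtain U where U: "subspace U" "A = (\<lambda>u. c + u) ` U" "aff_dim A = int (dim U)"
      using affine_eq_translate_subspace[OF sphere(3,5)] by blast
    have dimU: "dim U = i + 1"
      using U sphere by simp
    obtain V where V: "subspace V" "dim V = dim U + 1" "cone_section V = X"
      unfolding sphere(1) U(2) using sphere_as_section[OF U(1) sphere(2)] by blast
    have "U \<noteq> {0}"
      using dimU by auto
    then obtain u where "u \<in> U" "u \<noteq> 0"
      using subspace_0[OF U(1)] by blast
    \<comment> \<open>Antipodal points of the sphere: a direction exists because \<open>dim U = i + 1 > 0\<close>.\<close>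
    define v where "v = (r / norm u) *\<^sub>R u"
    have v: "v \<in> U" "- v \<in> U" "norm v = r"
      using U(1) \<open>u \<in> U\<close> \<open>u \<noteq> 0\<close> sphere(2) by (auto simp: v_def subspace_scale subspace_neg)
    have "v + v \<noteq> 0"
      using v(3) sphere(2) scaleR_2[of v] by auto
    then have "v \<noteq> - v"
      by (metis add.right_inverse)
    have "Some (c + v) \<in> X" "Some (c + - v) \<in> X"
      unfolding sphere(1) U(2) using v by (auto simp: dist_norm simp del: add_uminus_conv_diff)
    moreover have "Some (c + v) \<noteq> Some (c + - v)"
      using \<open>v \<noteq> - v\<close> by simp
    ultimately show ?thesis
      using proper_sectionsI[OF V(1,2)] V(3) dimU by simp
  next
    case flat
    then obtain p where p: "p \<in> A"
      by fastforce
    obtain U where U: "subspace U" "A = (\<lambda>u. p + u) ` U" "aff_dim A = int (dim U)"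
      using affine_eq_translate_subspace[OF flat(2) p] by blast
    obtain V where V: "subspace V" "dim V = dim U + 2" "cone_section V = X"
      unfolding flat(1) U(2) using flat_as_section[OF U(1)] by blast
    have "None \<in> X" "Some p \<in> X"
      using flat(1) p by auto
    then show ?thesis
      using proper_sectionsI[OF V(1,2)] V(3) U(3) flat(3) by (metis of_nat_eq_iff option.distinct(1))
  qed
next
  fix X :: "ext_quaternion set" assume "X \<in> proper_sections (i + 2)"
  then obtain V x y where V: "X = cone_section V" "subspace V" "dim V = i + 2"
    and xy: "x \<in> cone_section V" "y \<in> cone_section V" "x \<noteq> y"
    unfolding proper_sections_def by blast
  show "X \<in> sphere_family i"
  proof (cases "(0, 0, 1) \<in> V")
    case True
    obtain p where "Some p \<in> cone_section V"
      using xy by (metis not_None_eq)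
    then obtain U where U: "subspace U" "dim V = dim U + 2"
        "cone_section V = insert None (Some ` (\<lambda>u. p + u) ` U)"
      using unbounded_section_is_flat[OF V(2) True] by blast
    have "affine ((\<lambda>u. p + u) ` U)" "aff_dim ((\<lambda>u. p + u) ` U) = int i"
      using translate_subspace[OF U(1)] U(2) V(3) by simp_all
    then show ?thesis
      unfolding sphere_family_def affine_subspaces_def using U(3) V(1) by blast
  next
    case False
    then obtain p p' where "x = Some p" "y = Some p'"
      using xy by (cases x; cases y) (auto simp: cone_section_def)
    then have pp': "Some p \<in> cone_section V" "Some p' \<in> cone_section V" "p \<noteq> p'"
      using xy by auto
    obtain A c r where A: "affine A" "int (dim V) = aff_dim A + 1" "0 < r" "c \<in> A"
        "cone_section V = Some ` (sphere c r \<inter> A)"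
      by (rule bounded_section_is_sphere[OF V(2) False pp'])
    have "aff_dim A = int i + 1"
      using A(2) V(3) by simp
    then have "X \<in> round_spheres i"
      unfolding round_spheres_def V(1) using A by blast
    then show ?thesis
      by (simp add: sphere_family_def)
  qed
qed

section \<open>Homogeneous coordinates and Hermitian matrices\<close>

definition qcnj :: "quaternion \<Rightarrow> quaternion"
  where "qcnj q = Quaternion (re q) (- im1 q) (- im2 q) (- im3 q)"

lemma qcnj_sel [simp]:
  "re (qcnj q) = re q" "im1 (qcnj q) = - im1 q" "im2 (qcnj q) = - im2 q" "im3 (qcnj q) = - im3 q"
  by (simp_all add: qcnj_def)

lemma qcnj_simps [simp]:
  "qcnj 0 = 0" "qcnj 1 = 1" "qcnj (p + q) = qcnj p + qcnj q" "qcnj (p * q) = qcnj q * qcnj p"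
  "qcnj (k *\<^sub>R q) = k *\<^sub>R qcnj q" "qcnj (qcnj q) = q"
  by (simp_all add: quaternion_eq_iff algebra_simps)

lemma of_real_quaternion_sel [simp]:
  "re (of_real k) = k" "im1 (of_real k) = 0" "im2 (of_real k) = 0" "im3 (of_real k) = 0"
  by (simp_all add: of_real_def)

lemma norm_quaternion_sq: "(norm q)\<^sup>2 = (re q)\<^sup>2 + (im1 q)\<^sup>2 + (im2 q)\<^sup>2 + (im3 q)\<^sup>2"
  for q :: quaternion
  by (simp add: norm_quaternion_def)

lemma mult_qcnj: "q * qcnj q = of_real ((norm q)\<^sup>2)"
  by (simp add: norm_quaternion_sq quaternion_eq_iff) (simp add: power2_eq_square)

lemma norm_qcnj [simp]: "norm (qcnj q) = norm q"
  by (simp add: norm_quaternion_def)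

lemma inverse_eq_qcnj: "inverse q = (1 / (norm q)\<^sup>2) *\<^sub>R qcnj q"
  by (simp add: inverse_quaternion_def qcnj_def norm_quaternion_sq)

text \<open>The quotient \<open>w\<^sub>1 w\<^sub>2\<inverse>\<close> is unchanged when \<open>w\<close> is scaled on the right, so this is the
  identification of the extended quaternions with the projective line of the right vector space
  \<open>\<H>\<^sup>2\<close>. Matrices act on the left and hence commute with the scaling.\<close>

definition point :: "quaternion^2 \<Rightarrow> ext_quaternion"
  where "point w = (if w$2 = 0 then None else Some (w$1 * inverse (w$2)))"

lemma point_surj: obtains w where "w \<noteq> 0" "point w = z"
proof (cases z)
  case None
  show thesis
    by (rule that[of "vector [1, 0]"]) (auto simp: None point_def vec_eq_iff forall_2)
next
  case (Some q)
  show thesis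
    by (rule that[of "vector [q, 1]"]) (auto simp: Some point_def vec_eq_iff forall_2)
qed

lemma frac_lin_point:
  assumes "w \<noteq> 0"
  shows "frac_lin M (point w) = point (M *v w)"
proof -
  have Mw: "(M *v w)$1 = M$1$1 * w$1 + M$1$2 * w$2" "(M *v w)$2 = M$2$1 * w$1 + M$2$2 * w$2"
    by (simp_all add: matrix_vector_mult_def sum_2)
  show ?thesis
  proof (cases "w$2 = 0")
    case True
    then have "w$1 \<noteq> 0"
      using assms by (auto simp: vec_eq_iff forall_2)
    then show ?thesis
      using True by (auto simp: frac_lin_def point_def Mw nonzero_inverse_mult_distrib mult.assoc)
        (simp add: mult.assoc[symmetric])
  next
    case False
    have split: "a * (w$1 * inverse (w$2)) + b = (a * w$1 + b * w$2) * inverse (w$2)" for a b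
      using False by (simp add: distrib_right mult.assoc)
    have "inverse (w$2) * (w$2 * y) = y" for y
      using False by (simp add: mult.assoc[symmetric])
    then have cancel: "x * inverse (w$2) * inverse (y * inverse (w$2)) = x * inverse y" for x y
      using False by (cases "y = 0") (simp_all add: nonzero_inverse_mult_distrib mult.assoc)
    show ?thesis
      using False by (simp add: frac_lin_def point_def Mw split cancel)
  qed
qed

text \<open>In homogeneous coordinates composition is matrix multiplication, so an inverse matrix
  provides an inverse map.\<close>

lemma bij_frac_lin:
  assumes "invertible M"
  shows "bij (frac_lin M)"
proof -
  obtain N where N: "M ** N = mat 1" "N ** M = mat 1"
    using assms by (auto simp: invertible_def)
  have inv: "frac_lin P (frac_lin Q z) = z" if PQ: "P ** Q = mat 1" for P Q z
  proof -
    obtain w where w: "w \<noteq> 0" "point w = z"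
      by (rule point_surj)
    have PQw: "P *v (Q *v w) = w"
      by (simp add: matrix_vector_mul_assoc PQ)
    then have "Q *v w \<noteq> 0"
      using w(1) by auto
    then show ?thesis
      using w PQw by (metis frac_lin_point)
  qed
  show ?thesis
    by (rule o_bij[of "frac_lin N"]) (auto simp: fun_eq_iff inv N)
qed

definition adjoint_matrix :: "quaternion^'n^'m \<Rightarrow> quaternion^'m^'n"
  where "adjoint_matrix M = (\<chi> i j. qcnj (M$j$i))"

definition congruence :: "quaternion^2^2 \<Rightarrow> quaternion^2^2 \<Rightarrow> quaternion^2^2"
  where "congruence M X = M ** X ** adjoint_matrix M"

text \<open>The order of the coordinates makes \<open>herm (1, q, \<bar>q\<bar>\<^sup>2)\<close> equal to \<open>w w\<^sup>*\<close> for \<open>w = (q, 1)\<close>.\<close>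

definition herm :: "real \<times> quaternion \<times> real \<Rightarrow> quaternion^2^2"
  where "herm = (\<lambda>(s, q, t). vector [vector [of_real t, q], vector [qcnj q, of_real s]])"

definition outer :: "quaternion^2 \<Rightarrow> quaternion^2^2"
  where "outer w = (\<chi> i j. w$i * qcnj (w$j))"

lemma linear_congruence: "linear (congruence M)"
  by (intro linearI)
    (simp_all add: congruence_def vec_eq_iff forall_2 matrix_matrix_mult_def sum_2 algebra_simps)

lemma adjoint_matrix_mult: "adjoint_matrix (M ** N) = adjoint_matrix N ** adjoint_matrix M"
  for M N :: "quaternion^2^2"
  by (simp add: adjoint_matrix_def vec_eq_iff forall_2 matrix_matrix_mult_def sum_2)

lemma congruence_mult: "congruence M (congruence N X) = congruence (M ** N) X"
  by (simp add: congruence_def adjoint_matrix_mult matrix_mul_assoc)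

lemma congruence_one: "congruence (mat 1) X = X"
proof -
  have "adjoint_matrix (mat 1 :: quaternion^2^2) = mat 1"
    by (simp add: adjoint_matrix_def mat_def vec_eq_iff forall_2)
  then show ?thesis
    by (simp add: congruence_def)
qed

lemma inj_congruence:
  assumes "invertible M"
  shows "inj (congruence M)"
proof -
  obtain N where "N ** M = mat 1"
    using assms by (auto simp: invertible_def)
  then show ?thesis
    by (metis congruence_mult congruence_one injI)
qed

lemma linear_herm: "linear herm"
  by (intro linearI) (auto simp: herm_def vec_eq_iff forall_2 of_real_def algebra_simps)

lemma inj_herm: "inj herm"
  by (auto intro!: injI simp: herm_def vec_eq_iff forall_2)

lemma range_herm: "range herm = {X. adjoint_matrix X = X}"
proof (intro equalityI subsetI)
  fix X assume "X \<in> range herm"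
  then show "X \<in> {X. adjoint_matrix X = X}"
    by (auto simp: herm_def adjoint_matrix_def vec_eq_iff forall_2 quaternion_eq_iff)
next
  fix X :: "quaternion^2^2" assume "X \<in> {X. adjoint_matrix X = X}"
  then have adj: "qcnj (X$j$i) = X$i$j" for i j
    by (simp add: adjoint_matrix_def vec_eq_iff)
  have diag: "of_real (re (X$i$i)) = X$i$i" for i
    using arg_cong[OF adj[of i i], of im1] arg_cong[OF adj[of i i], of im2]
      arg_cong[OF adj[of i i], of im3]
    by (simp add: quaternion_eq_iff)
  have "X = herm (re (X$2$2), X$1$2, re (X$1$1))"
    by (simp add: herm_def vec_eq_iff forall_2 adj diag)
  then show "X \<in> range herm" by blast
qed

text \<open>Congruence preserves Hermitian matrices, because \<open>(M X M\<^sup>*)\<^sup>* = M X\<^sup>* M\<^sup>*\<close>.\<close>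

lemma congruence_herm_in_range: "congruence M (herm v) \<in> range herm"
proof -
  have "adjoint_matrix (herm v) = herm v"
    using range_herm by blast
  moreover have "adjoint_matrix (adjoint_matrix M) = M"
    by (simp add: adjoint_matrix_def vec_eq_iff)
  ultimately show ?thesis
    by (simp add: range_herm congruence_def adjoint_matrix_mult matrix_mul_assoc)
qed

lemma congruence_outer: "congruence M (outer w) = outer (M *v w)"
  by (simp add: congruence_def outer_def adjoint_matrix_def vec_eq_iff forall_2
      matrix_matrix_mult_def matrix_vector_mult_def sum_2 algebra_simps)

text \<open>The factor is \<open>\<bar>w\<^sub>2\<bar>\<^sup>2\<close>, or \<open>\<bar>w\<^sub>1\<bar>\<^sup>2\<close> at \<open>\<infinity>\<close>: a right multiple \<open>v \<lambda>\<close> of a vector \<open>v\<close> has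
  \<open>(v \<lambda>) (v \<lambda>)\<^sup>* = \<bar>\<lambda>\<bar>\<^sup>2 v v\<^sup>*\<close>.\<close>

lemma herm_lift_point:
  assumes "w \<noteq> 0"
  obtains k where "k \<noteq> 0" "outer w = k *\<^sub>R herm (lift (point w))"
proof (cases "w$2 = 0")
  case True
  then have "w$1 \<noteq> 0"
    using assms by (auto simp: vec_eq_iff forall_2)
  moreover have "outer w = (norm (w$1))\<^sup>2 *\<^sub>R herm (lift (point w))"
    using True by (auto simp: outer_def herm_def point_def vec_eq_iff forall_2 mult_qcnj of_real_def)
  ultimately show thesis
    using that[of "(norm (w$1))\<^sup>2"] by simp
next
  case False
  have "outer w = (norm (w$2))\<^sup>2 *\<^sub>R herm (lift (point w))"
    using False by (auto simp: outer_def herm_def point_def vec_eq_iff forall_2 mult_qcnj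
        inverse_eq_qcnj of_real_def norm_mult power_mult_distrib power2_eq_square divide_simps)
  then show thesis
    using that[of "(norm (w$2))\<^sup>2"] False by simp
qed

text \<open>Both sides are real multiples of \<open>(M w) (M w)\<^sup>*\<close>, where \<open>w\<close> are homogeneous coordinates
  of \<open>z\<close>. The factor depends on \<open>z\<close>, but linear subspaces do not notice it.\<close>

lemma herm_lift_frac_lin:
  assumes "invertible M"
  obtains k where "k \<noteq> 0"
    "herm (lift (frac_lin M z)) = k *\<^sub>R congruence M (herm (lift z))"
proof -
  obtain w where w: "w \<noteq> 0" "point w = z"
    by (rule point_surj)
  have "M *v w \<noteq> 0"
    using assms w(1) unfolding invertible_def
    by (metis matrix_vector_mul_assoc matrix_vector_mul_lid matrix_vector_mult_0_right)
  then obtain k where k: "k \<noteq> 0" "outer (M *v w) = k *\<^sub>R herm (lift (point (M *v w)))"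
    using herm_lift_point by blast
  obtain l where l: "l \<noteq> 0" "outer w = l *\<^sub>R herm (lift z)"
    using herm_lift_point[OF w(1)] w(2) by metis
  have "k *\<^sub>R herm (lift (frac_lin M z)) = l *\<^sub>R congruence M (herm (lift z))"
    using k(2) l(2) frac_lin_point[OF w(1), of M] w(2) congruence_outer[of M w]
      linear_scale[OF linear_congruence] by metis
  then have "herm (lift (frac_lin M z)) = (l / k) *\<^sub>R congruence M (herm (lift z))"
    using k(1) by (metis (no_types, lifting) divide_inverse_commute right_inverse scaleR_one
        scaleR_scaleR mult.commute)
  then show thesis
    using that[of "l / k"] k(1) l(1) by simp
qed

lemma subspace_scale_iff:
  assumes "subspace S" "k \<noteq> 0"
  shows "k *\<^sub>R x \<in> S \<longleftrightarrow> x \<in> S"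
  using subspace_scale[OF assms(1), of x k] subspace_scale[OF assms(1), of "k *\<^sub>R x" "1 / k"]
    assms(2) by auto

text \<open>The image of the section by \<open>V\<close> is the section by the subspace corresponding to
  \<open>{M X M\<^sup>* | X \<in> herm ` V}\<close>, which has the same dimension because congruence by an invertible
  matrix is injective.\<close>

lemma frac_lin_proper_section:
  assumes "invertible M" "X \<in> proper_sections n"
  shows "frac_lin M ` X \<in> proper_sections n"
proof -
  obtain V x y where X: "X = cone_section V" and V: "subspace V" "dim V = n"
    and xy: "x \<in> X" "y \<in> X" "x \<noteq> y"
    using assms(2) unfolding proper_sections_def by blast
  let ?W = "congruence M ` herm ` V"
  have W: "subspace ?W"
    by (intro linear_subspace_image linear_congruence linear_herm V)
  define V' where "V' = herm -` ?W"
  have V': "subspace V'"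
    unfolding V'_def by (rule linear_subspace_vimage[OF linear_herm W])
  have "herm ` V' = ?W"
    unfolding V'_def using congruence_herm_in_range by auto
  moreover have "dim (herm ` V') = dim V'"
    by (rule dim_image_eq[OF linear_herm]) (rule inj_on_subset[OF inj_herm subset_UNIV])
  moreover have "dim ?W = dim (herm ` V)"
    by (rule dim_image_eq[OF linear_congruence])
      (rule inj_on_subset[OF inj_congruence[OF assms(1)] subset_UNIV])
  moreover have "dim (herm ` V) = dim V"
    by (rule dim_image_eq[OF linear_herm]) (rule inj_on_subset[OF inj_herm subset_UNIV])
  ultimately have dim: "dim V' = n"
    using V by simp
  have iff: "frac_lin M z \<in> cone_section V' \<longleftrightarrow> z \<in> X" for z
  proof -
    obtain k where k: "k \<noteq> 0" "herm (lift (frac_lin M z)) = k *\<^sub>R congruence M (herm (lift z))"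
      by (rule herm_lift_frac_lin[OF assms(1)])
    have "frac_lin M z \<in> cone_section V' \<longleftrightarrow> k *\<^sub>R congruence M (herm (lift z)) \<in> ?W"
      by (simp add: cone_section_def V'_def k(2))
    also have "\<dots> \<longleftrightarrow> congruence M (herm (lift z)) \<in> ?W"
      by (rule subspace_scale_iff[OF W k(1)])
    also have "\<dots> \<longleftrightarrow> lift z \<in> V"
      using inj_congruence[OF assms(1)] inj_herm by (simp add: inj_image_mem_iff)
    finally show ?thesis
      by (simp add: X cone_section_def)
  qed
  have bij: "bij (frac_lin M)"
    by (rule bij_frac_lin[OF assms(1)])
  have img: "frac_lin M ` X = cone_section V'"
  proof (intro equalityI subsetI)
    fix z assume "z \<in> cone_section V'"
    then show "z \<in> frac_lin M ` X"
      using iff bij by (metis bij_pointE imageI)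
  qed (use iff in auto)
  have "frac_lin M x \<noteq> frac_lin M y"
    using bij xy(3) by (metis bij_pointE)
  then show ?thesis
    unfolding proper_sections_def using V' dim iff img xy by blast
qed

theorem theorem1p5:
  fixes i :: nat
  assumes "i \<in> {3, 2, 1}"
  shows "\<forall>F \<in> frac_lin_group. \<forall>X \<in> sphere_family i. F ` X \<in> sphere_family i"
  unfolding sphere_family_eq_proper_sections frac_lin_group_def
  by (auto intro: frac_lin_proper_section)

end
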